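(* Let $(X,d)$ be a metric space. Then the following conditions are equivalent: (a) The completion of $(X,d)$ is weak $G$-complete. (b) Every subset of $X$ that is complete (as a metric subspace) is weak $G$-complete (as a metric subspace). (c) Given any metric space $(Y,\rho)$ and any Cauchy-continuous map $f:(X,d)\to(Y,\rho)$, $f$ takes every $G$-Cauchy sequence of $(X,d)$ to a cofinally Cauchy sequence of $(Y,\rho)$. (d) Given any Cauchy-continuous map $f:(X,d)\to\mathbb R$, where $\mathbb R$ is endowed with the usual metric, $f$ takes every $G$-Cauchy sequence of $(X,d)$ to a cofinally Cauchy sequence of $\mathbb R$. (e) Every $G$-Cauchy sequence in $(X,d)$ has a Cauchy subsequence.
   Context: A sequence $(x_n)$ in a metric space $(X,d)$ is $G$-Cauchy if $\lim_{n\to\infty}d(x_n,x_{n+1})=0$. A metric space is weak $G$-complete if every $G$-Cauchy sequence in it clusters (has a cluster point). A sequence $(x_n)$ in a metric space $(X,d)$ is cofinally Cauchy if for every $\epsilon>0$ there is an infinite subset $\mathbb N_\epsilon$ of $\mathbb N$ such that $d(x_p,x_q)<\epsilon$ for all $p,q\in\mathbb N_\epsilon$. A map between metric spaces is Cauchy-continuous if it takes every Cauchy sequence to a Cauchy sequence. *)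

theory Defs
  imports "HOL-Analysis.Analysis"
begin

definition G_Cauchy :: "'a metric \<Rightarrow> (nat \<Rightarrow> 'a) \<Rightarrow> bool" where
  "G_Cauchy m \<sigma> \<longleftrightarrow>
     range \<sigma> \<subseteq> mspace m \<and> (\<lambda>n. mdist m (\<sigma> n) (\<sigma> (Suc n))) \<longlonglongrightarrow> 0"

text \<open>The sequential counterpart of \<^const>\<open>limitin\<close>, with ``frequently'' instead of ``eventually''.\<close>

definition cluster_point_in :: "'a topology \<Rightarrow> (nat \<Rightarrow> 'a) \<Rightarrow> 'a \<Rightarrow> bool" where
  "cluster_point_in T \<sigma> x \<longleftrightarrow>
     x \<in> topspace T \<and> (\<forall>U. openin T U \<and> x \<in> U \<longrightarrow> (\<exists>\<^sub>F n in sequentially. \<sigma> n \<in> U))"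

definition weak_G_complete :: "'a metric \<Rightarrow> bool" where
  "weak_G_complete m \<longleftrightarrow> (\<forall>\<sigma>. G_Cauchy m \<sigma> \<longrightarrow> (\<exists>x. cluster_point_in (mtopology_of m) \<sigma> x))"

definition cofinally_Cauchy :: "'a metric \<Rightarrow> (nat \<Rightarrow> 'a) \<Rightarrow> bool" where
  "cofinally_Cauchy m \<sigma> \<longleftrightarrow>
     range \<sigma> \<subseteq> mspace m \<and>
     (\<forall>\<epsilon>>0. \<exists>N :: nat set. infinite N \<and> (\<forall>p\<in>N. \<forall>q\<in>N. mdist m (\<sigma> p) (\<sigma> q) < \<epsilon>))"

text \<open>\<^const>\<open>Cauchy_continuous_map\<close> already forces \<open>f\<close> to map \<open>mspace m\<close> into \<open>mspace m'\<close>
  (apply it to constant sequences).\<close>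

definition Cauchy_continuous_maps_G_Cauchy_to_cofinally_Cauchy ::
    "'a metric \<Rightarrow> 'b metric \<Rightarrow> bool" where
  "Cauchy_continuous_maps_G_Cauchy_to_cofinally_Cauchy m m' \<longleftrightarrow>
     (\<forall>f. Cauchy_continuous_map m m' f \<longrightarrow>
        (\<forall>\<sigma>. G_Cauchy m \<sigma> \<longrightarrow> cofinally_Cauchy m' (f \<circ> \<sigma>)))"

text \<open>The completion is unique only up to isometry, so it is described by its defining property:
  \<open>m'\<close> is complete and \<open>e\<close> embeds \<open>m\<close> isometrically onto a dense subset of it.\<close>

definition is_completion :: "'a metric \<Rightarrow> 'b metric \<Rightarrow> ('a \<Rightarrow> 'b) \<Rightarrow> bool" where
  "is_completion m m' e \<longleftrightarrow>
     mcomplete_of m' \<and>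
     e \<in> mspace m \<rightarrow> mspace m' \<and>
     (\<forall>x\<in>mspace m. \<forall>y\<in>mspace m. mdist m' (e x) (e y) = mdist m x y) \<and>
     mtopology_of m' closure_of (e ` mspace m) = mspace m'"

lemma completion_exists:
  fixes m :: "'a metric"
  shows "\<exists>(m' :: ('a \<Rightarrow> real) metric) e. is_completion m m' e"
proof -
  obtain f :: "'a \<Rightarrow> 'a \<Rightarrow> real" and m' :: "('a \<Rightarrow> real) metric" where
    "mcomplete_of m'" "f \<in> mspace m \<rightarrow> mspace m'"
    "mtopology_of m' closure_of f ` mspace m = mspace m'"
    "\<And>x y. \<lbrakk>x \<in> mspace m; y \<in> mspace m\<rbrakk> \<Longrightarrow> mdist m' (f x) (f y) = mdist m x y"
    using Metric_space.metric_completion[OF Metric_space_mspace_mdist[of m]] by metis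
  then show ?thesis
    unfolding is_completion_def by blast
qed

end

theory Submission
  imports Defs
begin

text \<open>
  All the conditions are compared with the last one: every \<open>G\<close>-Cauchy sequence has a Cauchy
  subsequence, called \<open>G_Cauchy_subsequential\<close> below.

  In a complete space a sequence clusters exactly when it has a Cauchy subsequence, so there weak
  \<open>G\<close>-completeness and \<open>G_Cauchy_subsequential\<close> are the same property
  (\<open>weak_G_complete_iff_subsequential\<close>). The latter no longer mentions limits, and it
  passes between a space and its completion: a \<open>G\<close>-Cauchy sequence of the completion can be
  replaced by points of the dense subspace whose distances to it tend to 0, and such a replacement
  changes neither the \<open>G\<close>-Cauchy property nor the Cauchy property of a subsequence
  (\<open>G_Cauchy_subsequential_completion\<close>). It also passes to subspaces, which gives the
  condition on complete subsets. Conversely, if a sequence has no Cauchy subsequence, its range is a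
  complete subset in which it does not cluster (\<open>mcomplete_range_if_no_Cauchy_subsequence\<close>).

  A Cauchy-continuous map sends a Cauchy subsequence to a Cauchy subsequence, and a sequence with a
  Cauchy subsequence is cofinally Cauchy. For the converse, let \<open>\<sigma>\<close> have no Cauchy
  subsequence and put
  \<open>h x = inf\<^sub>n (d x (\<sigma> n) + 1 / (n + 1))\<close>.
  This function is 1-Lipschitz, and along a Cauchy sequence it cannot tend to 0: otherwise terms of
  \<open>\<sigma>\<close> with indices tending to infinity would approach that Cauchy sequence and so contain a
  Cauchy subsequence of \<open>\<sigma>\<close>. Hence \<open>1 / h\<close> is Cauchy-continuous. But
  \<open>h (\<sigma> n) \<le> 1 / (n + 1)\<close>, so \<open>1 / h\<close> tends to infinity along
  \<open>\<sigma>\<close>, and the image of \<open>\<sigma>\<close> is not cofinally Cauchy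
  (\<open>Cauchy_continuous_real_map_unbounded_along\<close>). A real-valued map can be read as a map
  into any type with at least as many elements as the reals by transporting the metric, which
  covers targets on an arbitrary such type.
\<close>

section \<open>Cauchy subsequences\<close>

abbreviation Cauchy_in :: "'a metric \<Rightarrow> (nat \<Rightarrow> 'a) \<Rightarrow> bool" where
  "Cauchy_in m \<sigma> \<equiv> Metric_space.MCauchy (mspace m) (mdist m) \<sigma>"

definition G_Cauchy_subsequential :: "'a metric \<Rightarrow> bool" where
  "G_Cauchy_subsequential m \<longleftrightarrow>
     (\<forall>\<sigma>. G_Cauchy m \<sigma> \<longrightarrow> (\<exists>r :: nat \<Rightarrow> nat. strict_mono r \<and> Cauchy_in m (\<sigma> \<circ> r)))"

lemma Cauchy_in_def:
  "Cauchy_in m \<sigma> \<longleftrightarrow> range \<sigma> \<subseteq> mspace m \<and>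
     (\<forall>\<epsilon>>0. \<exists>N. \<forall>n n'. N \<le> n \<longrightarrow> N \<le> n' \<longrightarrow> mdist m (\<sigma> n) (\<sigma> n') < \<epsilon>)"
  unfolding Metric_space.MCauchy_def[OF Metric_space_mspace_mdist] ..

lemma Cauchy_in_close:
  assumes x: "Cauchy_in m x" and y: "range y \<subseteq> mspace m"
    and close: "(\<lambda>k. mdist m (x k) (y k)) \<longlonglongrightarrow> 0"
  shows "Cauchy_in m y"
  unfolding Cauchy_in_def
proof (intro conjI allI impI)
  fix \<epsilon> :: real assume "\<epsilon> > 0"
  then have e: "\<epsilon> / 3 > 0" by simp
  obtain N where N: "\<And>n n'. N \<le> n \<Longrightarrow> N \<le> n' \<Longrightarrow> mdist m (x n) (x n') < \<epsilon> / 3"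
    using x e unfolding Cauchy_in_def by meson
  obtain K where K: "\<And>n. K \<le> n \<Longrightarrow> mdist m (x n) (y n) < \<epsilon> / 3"
    using order_tendstoD(2)[OF close e] unfolding eventually_sequentially by blast
  have "mdist m (y n) (y n') < \<epsilon>" if "max N K \<le> n" "max N K \<le> n'" for n n'
  proof -
    have M: "x n \<in> mspace m" "x n' \<in> mspace m" "y n \<in> mspace m" "y n' \<in> mspace m"
      using x y unfolding Cauchy_in_def by auto
    have "mdist m (y n) (y n') \<le> mdist m (y n) (x n) + mdist m (x n) (y n')"
      "mdist m (x n) (y n') \<le> mdist m (x n) (x n') + mdist m (x n') (y n')"
      using M by (auto intro: mdist_triangle)
    moreover have "mdist m (y n) (x n) = mdist m (x n) (y n)" by (rule mdist_commute)
    ultimately show ?thesis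
      using N[of n n'] K[of n] K[of n'] that by auto
  qed
  then show "\<exists>N. \<forall>n n'. N \<le> n \<longrightarrow> N \<le> n' \<longrightarrow> mdist m (y n) (y n') < \<epsilon>" by blast
qed (use y in auto)

lemma Cauchy_in_isometry_iff:
  assumes e: "e \<in> mspace m \<rightarrow> mspace m'"
    and iso: "\<And>x y. x \<in> mspace m \<Longrightarrow> y \<in> mspace m \<Longrightarrow> mdist m' (e x) (e y) = mdist m x y"
    and \<sigma>: "range \<sigma> \<subseteq> mspace m"
  shows "Cauchy_in m' (e \<circ> \<sigma>) \<longleftrightarrow> Cauchy_in m \<sigma>"
proof -
  have "mdist m' (e (\<sigma> i)) (e (\<sigma> j)) = mdist m (\<sigma> i) (\<sigma> j)" for i j
    using \<sigma> by (intro iso) auto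
  moreover have "range (e \<circ> \<sigma>) \<subseteq> mspace m'" using e \<sigma> by auto
  ultimately show ?thesis using \<sigma> by (simp add: Cauchy_in_def)
qed

lemma strict_mono_subsequence_of_infinite_range:
  fixes n :: "nat \<Rightarrow> nat"
  assumes "infinite (range n)"
  obtains s :: "nat \<Rightarrow> nat" where "strict_mono s" "strict_mono (n \<circ> s)"
proof -
  \<comment> \<open>Infinitely many values cannot all come from the finitely many arguments up to \<open>a\<close> or lie below
    \<open>n a\<close>. The conjunct \<open>True\<close> is the trivial invariant required by dependent choice.\<close>
  have step: "\<exists>b. True \<and> a < b \<and> n a < n b" for a
  proof (rule ccontr)
    assume "\<not> ?thesis"
    then have "n b \<le> n a \<or> b \<in> {..a}" for b by (metis atMost_iff not_le)
    then have "range n \<subseteq> {..n a} \<union> n ` {..a}" by auto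
    then show False using assms finite_subset by blast
  qed
  obtain s where "\<And>k. s k < s (Suc k) \<and> n (s k) < n (s (Suc k))"
    using dependent_nat_choice[of "\<lambda>_ _. True" "\<lambda>_ a b. a < b \<and> n a < n b"] step by auto
  then show thesis by (intro that[of s]) (auto simp: strict_mono_Suc_iff)
qed

text \<open>Several constructions below choose indices one at a time, with no control over their order.
  This lemma turns such a choice into a genuine subsequence as soon as infinitely many different
  indices occur.\<close>

lemma Cauchy_subsequence_of_reindexing:
  assumes "Cauchy_in m (\<sigma> \<circ> n)" and "infinite (range n)"
  shows "\<exists>r :: nat \<Rightarrow> nat. strict_mono r \<and> Cauchy_in m (\<sigma> \<circ> r)"
proof -
  obtain s :: "nat \<Rightarrow> nat" where s: "strict_mono s" "strict_mono (n \<circ> s)"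
    by (rule strict_mono_subsequence_of_infinite_range[OF assms(2)])
  have "Cauchy_in m ((\<sigma> \<circ> n) \<circ> s)"
    by (rule Metric_space.MCauchy_subsequence[OF Metric_space_mspace_mdist s(1) assms(1)])
  then show ?thesis using s(2) by (metis comp_assoc)
qed

lemma infinite_range_if_inverse_tendsto_0:
  fixes n :: "nat \<Rightarrow> nat"
  assumes "(\<lambda>k. inverse (real (Suc (n k)))) \<longlonglongrightarrow> 0"
  shows "infinite (range n)"
proof
  assume "finite (range n)"
  then obtain B where B: "\<And>k. n k \<le> B" 
    using finite_nat_set_iff_bounded_le by auto
  have "eventually (\<lambda>k. inverse (real (Suc (n k))) < inverse (real (Suc B))) sequentially"
    by (rule order_tendstoD(2)[OF assms]) simp
  then obtain k where "inverse (real (Suc (n k))) < inverse (real (Suc B))"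
    using eventually_happens'[OF sequentially_bot] by blast
  then show False using B[of k] by (simp add: field_simps)
qed

text \<open>Points of \<open>\<sigma>\<close> chosen ever closer to a cluster point follow a constant sequence, hence are
  Cauchy. Completeness is what turns a Cauchy subsequence back into a cluster point.\<close>

lemma cluster_point_iff_Cauchy_subsequence:
  assumes complete: "mcomplete_of m" and \<sigma>: "range \<sigma> \<subseteq> mspace m"
  shows "(\<exists>x. cluster_point_in (mtopology_of m) \<sigma> x) \<longleftrightarrow>
         (\<exists>r :: nat \<Rightarrow> nat. strict_mono r \<and> Cauchy_in m (\<sigma> \<circ> r))"
proof
  interpret Metric_space "mspace m" "mdist m" by (rule Metric_space_mspace_mdist)
  assume "\<exists>x. cluster_point_in (mtopology_of m) \<sigma> x"
  then obtain x where x: "x \<in> mspace m"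
    and freq: "\<And>U. openin mtopology U \<Longrightarrow> x \<in> U \<Longrightarrow> (\<exists>\<^sub>F n in sequentially. \<sigma> n \<in> U)"
    unfolding cluster_point_in_def by (auto simp: mtopology_of_def)
  have "\<exists>n\<ge>k. mdist m x (\<sigma> n) < inverse (real (Suc k))" for k
    using freq[of "mball x (inverse (real (Suc k)))"] x
    by (auto simp: frequently_sequentially)
  then obtain n where n: "\<And>k. n k \<ge> k" "\<And>k. mdist m x (\<sigma> (n k)) < inverse (real (Suc k))"
    by metis
  have "(\<lambda>k. mdist m x (\<sigma> (n k))) \<longlonglongrightarrow> 0"
    by (rule tendsto_sandwich[OF _ _ tendsto_const LIMSEQ_inverse_real_of_nat])
      (auto intro!: always_eventually less_imp_le n(2) simp del: of_nat_Suc)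
  then have lim: "(\<lambda>k. mdist m x ((\<sigma> \<circ> n) k)) \<longlonglongrightarrow> 0" by simp
  have "range (\<sigma> \<circ> n) \<subseteq> mspace m" using \<sigma> by auto
  then have "Cauchy_in m (\<sigma> \<circ> n)"
    by (rule Cauchy_in_close[OF MCauchy_const[THEN iffD2, OF x] _ lim])
  moreover have "infinite (range n)"
    unfolding infinite_nat_iff_unbounded_le
  proof
    fix k show "\<exists>j\<ge>k. j \<in> range n" using n(1)[of k] by (intro exI[of _ "n k"]) simp
  qed
  ultimately show "\<exists>r :: nat \<Rightarrow> nat. strict_mono r \<and> Cauchy_in m (\<sigma> \<circ> r)"
    by (rule Cauchy_subsequence_of_reindexing)
next
  assume "\<exists>r :: nat \<Rightarrow> nat. strict_mono r \<and> Cauchy_in m (\<sigma> \<circ> r)"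
  then obtain r :: "nat \<Rightarrow> nat" where r: "strict_mono r" and "Cauchy_in m (\<sigma> \<circ> r)" by blast
  then obtain x where x: "limitin (mtopology_of m) (\<sigma> \<circ> r) x sequentially"
    using complete
    unfolding mcomplete_of_def Metric_space.mcomplete_def[OF Metric_space_mspace_mdist] mtopology_of_def
    by meson
  have "\<exists>\<^sub>F n in sequentially. \<sigma> n \<in> U" if "openin (mtopology_of m) U" "x \<in> U" for U
  proof -
    have "\<forall>\<^sub>F k in sequentially. \<sigma> (r k) \<in> U" using x that by (auto simp: limitin_def)
    then obtain K where K: "\<And>k. K \<le> k \<Longrightarrow> \<sigma> (r k) \<in> U"
      by (auto simp: eventually_sequentially)
    show ?thesis
      unfolding frequently_sequentially
    proof
      fix N
      have "N \<le> r (max N K)" using seq_suble[OF r, of "max N K"] by simp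
      then show "\<exists>n\<ge>N. \<sigma> n \<in> U" using K[of "max N K"] by auto
    qed
  qed
  then have "cluster_point_in (mtopology_of m) \<sigma> x"
    using x unfolding cluster_point_in_def by (auto simp: limitin_def)
  then show "\<exists>x. cluster_point_in (mtopology_of m) \<sigma> x" ..
qed

corollary weak_G_complete_iff_subsequential:
  assumes "mcomplete_of m"
  shows "weak_G_complete m \<longleftrightarrow> G_Cauchy_subsequential m"
  unfolding weak_G_complete_def G_Cauchy_subsequential_def
proof (intro all_cong1 imp_cong refl)
  fix \<sigma> assume "G_Cauchy m \<sigma>"
  then have "range \<sigma> \<subseteq> mspace m" by (simp add: G_Cauchy_def)
  then show "(\<exists>x. cluster_point_in (mtopology_of m) \<sigma> x) \<longleftrightarrow>
      (\<exists>r :: nat \<Rightarrow> nat. strict_mono r \<and> Cauchy_in m (\<sigma> \<circ> r))"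
    by (rule cluster_point_iff_Cauchy_subsequence[OF assms])
qed

section \<open>Passing to the completion\<close>

lemma G_Cauchy_close:
  assumes x: "G_Cauchy m x" and y: "range y \<subseteq> mspace m"
    and close: "(\<lambda>k. mdist m (x k) (y k)) \<longlonglongrightarrow> 0"
  shows "G_Cauchy m y"
proof -
  have M: "x n \<in> mspace m" "y n \<in> mspace m" for n
    using x y unfolding G_Cauchy_def by auto
  have bound: "mdist m (y n) (y (Suc n)) \<le>
      mdist m (x n) (y n) + (mdist m (x n) (x (Suc n)) + mdist m (x (Suc n)) (y (Suc n)))" for n
    using mdist_triangle[of "y n" m "x n" "y (Suc n)"] mdist_triangle[of "x n" m "x (Suc n)" "y (Suc n)"]
      M mdist_commute[of m "x n" "y n"] by simp
  have lim: "(\<lambda>n. mdist m (x n) (y n) + (mdist m (x n) (x (Suc n)) + mdist m (x (Suc n)) (y (Suc n))))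
      \<longlonglongrightarrow> 0"
    using tendsto_add[OF close tendsto_add[OF _ LIMSEQ_Suc[OF close]]] x
    unfolding G_Cauchy_def by fastforce
  have "(\<lambda>n. mdist m (y n) (y (Suc n))) \<longlonglongrightarrow> 0"
    by (rule tendsto_sandwich[OF _ _ tendsto_const lim]) (auto intro!: always_eventually bound)
  then show ?thesis using y by (simp add: G_Cauchy_def)
qed

text \<open>Pulling back along the isometry settles one direction. The other needs density: approximating
  the \<open>n\<close>-th term within \<open>1 / (n + 1)\<close> makes the error vanish asymptotically, so both the
  \<open>G\<close>-Cauchy property and the Cauchy subsequence can be carried across.\<close>

lemma G_Cauchy_subsequential_completion:
  assumes "is_completion m m' e"
  shows "G_Cauchy_subsequential m' \<longleftrightarrow> G_Cauchy_subsequential m"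
proof
  have e: "e \<in> mspace m \<rightarrow> mspace m'"
    and iso: "\<And>x y. x \<in> mspace m \<Longrightarrow> y \<in> mspace m \<Longrightarrow> mdist m' (e x) (e y) = mdist m x y"
    and dense: "mtopology_of m' closure_of (e ` mspace m) = mspace m'"
    using assms unfolding is_completion_def by auto
  have G_iso: "G_Cauchy m' (e \<circ> \<sigma>) \<longleftrightarrow> G_Cauchy m \<sigma>" if "range \<sigma> \<subseteq> mspace m" for \<sigma>
  proof -
    have "mdist m' (e (\<sigma> n)) (e (\<sigma> (Suc n))) = mdist m (\<sigma> n) (\<sigma> (Suc n))" for n
      using that by (intro iso) auto
    moreover have "range (e \<circ> \<sigma>) \<subseteq> mspace m'" using e that by auto
    ultimately show ?thesis using that by (simp add: G_Cauchy_def)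
  qed
  have Cauchy_iso: "Cauchy_in m' (e \<circ> \<sigma> \<circ> r) \<longleftrightarrow> Cauchy_in m (\<sigma> \<circ> r)"
    if "range \<sigma> \<subseteq> mspace m" for \<sigma> and r :: "nat \<Rightarrow> nat"
    unfolding comp_assoc using that by (intro Cauchy_in_isometry_iff e iso) auto
  {
    assume m': "G_Cauchy_subsequential m'"
    show "G_Cauchy_subsequential m"
      unfolding G_Cauchy_subsequential_def
    proof (intro allI impI)
      fix \<sigma> assume \<sigma>: "G_Cauchy m \<sigma>"
      then have ran: "range \<sigma> \<subseteq> mspace m" by (simp add: G_Cauchy_def)
      show "\<exists>r :: nat \<Rightarrow> nat. strict_mono r \<and> Cauchy_in m (\<sigma> \<circ> r)"
        using m' \<sigma> G_iso[OF ran] Cauchy_iso[OF ran] unfolding G_Cauchy_subsequential_def by blast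
    qed
  next
    assume m: "G_Cauchy_subsequential m"
    show "G_Cauchy_subsequential m'"
      unfolding G_Cauchy_subsequential_def
    proof (intro allI impI)
      fix \<tau> assume \<tau>: "G_Cauchy m' \<tau>"
      have "\<exists>x\<in>mspace m. mdist m' (\<tau> n) (e x) < inverse (real (Suc n))" for n
      proof -
        have "\<tau> n \<in> mtopology_of m' closure_of (e ` mspace m)"
          using \<tau> dense by (auto simp: G_Cauchy_def)
        then have "\<forall>\<epsilon>>0. \<exists>y \<in> e ` mspace m. y \<in> Metric_space.mball (mspace m') (mdist m') (\<tau> n) \<epsilon>"
          unfolding mtopology_of_def Metric_space.metric_closure_of[OF Metric_space_mspace_mdist]
          by simp
        moreover have "inverse (real (Suc n)) > 0" by simp
        ultimately obtain y where "y \<in> e ` mspace m"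
          "y \<in> Metric_space.mball (mspace m') (mdist m') (\<tau> n) (inverse (real (Suc n)))" by meson
        then show ?thesis
          unfolding Metric_space.in_mball[OF Metric_space_mspace_mdist] by blast
      qed
      then obtain \<sigma> where \<sigma>: "\<And>n. \<sigma> n \<in> mspace m"
        "\<And>n. mdist m' (\<tau> n) (e (\<sigma> n)) < inverse (real (Suc n))"
        by metis
      then have ran: "range \<sigma> \<subseteq> mspace m" by auto
      have close: "(\<lambda>n. mdist m' (\<tau> n) (e (\<sigma> n))) \<longlonglongrightarrow> 0"
        by (rule tendsto_sandwich[OF _ _ tendsto_const LIMSEQ_inverse_real_of_nat])
          (auto intro!: always_eventually less_imp_le \<sigma>(2) simp del: of_nat_Suc)
      have "G_Cauchy m' (e \<circ> \<sigma>)"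
        using \<sigma>(1) e close by (intro G_Cauchy_close[OF \<tau>]) auto
      then obtain r :: "nat \<Rightarrow> nat" where r: "strict_mono r" "Cauchy_in m' (e \<circ> \<sigma> \<circ> r)"
        using m G_iso[OF ran] Cauchy_iso[OF ran] unfolding G_Cauchy_subsequential_def by blast
      have "(\<lambda>k. mdist m' ((e \<circ> \<sigma> \<circ> r) k) ((\<tau> \<circ> r) k)) \<longlonglongrightarrow> 0"
        using LIMSEQ_subseq_LIMSEQ[OF close r(1)] by (simp add: o_def mdist_commute)
      then have "Cauchy_in m' (\<tau> \<circ> r)"
        using \<tau> by (intro Cauchy_in_close[OF r(2)]) (auto simp: G_Cauchy_def)
      then show "\<exists>r :: nat \<Rightarrow> nat. strict_mono r \<and> Cauchy_in m' (\<tau> \<circ> r)"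
        using r(1) by blast
    qed
  }
qed

section \<open>Complete subsets\<close>

lemma Cauchy_in_submetric:
  "Cauchy_in (submetric m A) \<sigma> \<longleftrightarrow> range \<sigma> \<subseteq> A \<and> Cauchy_in m \<sigma>"
  unfolding Cauchy_in_def by auto

lemma G_Cauchy_submetric:
  "G_Cauchy (submetric m A) \<sigma> \<longleftrightarrow> range \<sigma> \<subseteq> A \<and> G_Cauchy m \<sigma>"
  by (auto simp: G_Cauchy_def)

lemma G_Cauchy_subsequential_submetric:
  assumes "G_Cauchy_subsequential m"
  shows "G_Cauchy_subsequential (submetric m A)"
  unfolding G_Cauchy_subsequential_def Cauchy_in_submetric G_Cauchy_submetric
proof (intro allI impI)
  fix \<sigma> assume \<sigma>: "range \<sigma> \<subseteq> A \<and> G_Cauchy m \<sigma>"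
  then obtain r :: "nat \<Rightarrow> nat" where "strict_mono r" "Cauchy_in m (\<sigma> \<circ> r)"
    using assms unfolding G_Cauchy_subsequential_def by blast
  moreover have "range (\<sigma> \<circ> r) \<subseteq> A" using \<sigma> by auto
  ultimately show "\<exists>r :: nat \<Rightarrow> nat. strict_mono r \<and> range (\<sigma> \<circ> r) \<subseteq> A \<and> Cauchy_in m (\<sigma> \<circ> r)"
    by blast
qed

text \<open>A Cauchy sequence in the range of \<open>\<sigma>\<close> can use only finitely many indices, since
  infinitely many would yield a Cauchy subsequence of \<open>\<sigma>\<close>. It therefore takes one value
  infinitely often and converges to it.\<close>

lemma mcomplete_range_if_no_Cauchy_subsequence:
  assumes \<sigma>: "range \<sigma> \<subseteq> mspace m"
    and none: "\<not> (\<exists>r :: nat \<Rightarrow> nat. strict_mono r \<and> Cauchy_in m (\<sigma> \<circ> r))"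
  shows "mcomplete_of (submetric m (range \<sigma>))"
proof -
  interpret S: Metric_space "mspace (submetric m (range \<sigma>))" "mdist (submetric m (range \<sigma>))"
    by (rule Metric_space_mspace_mdist)
  have "\<exists>x. limitin S.mtopology y x sequentially" if y: "S.MCauchy y" for y
  proof -
    have "range y \<subseteq> range \<sigma>" "Cauchy_in m y" using y unfolding Cauchy_in_submetric by auto
    then have "\<forall>k. \<exists>i. y k = \<sigma> i" by auto
    then obtain n where "\<And>k. y k = \<sigma> (n k)" by metis
    then have n: "y = \<sigma> \<circ> n" by auto
    have "finite (range n)"
      using Cauchy_subsequence_of_reindexing[of m \<sigma> n] none \<open>Cauchy_in m y\<close> n by blast
    then obtain i where i: "infinite {k. n k = i}"
      using pigeonhole_infinite[of "UNIV :: nat set" n] by auto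
    define r where "r = enumerate {k. n k = i}"
    have r: "strict_mono r" "\<And>k. n (r k) = i"
      using strict_mono_enumerate[OF i] enumerate_in_set[OF i] by (auto simp: r_def)
    have "\<sigma> i \<in> topspace S.mtopology" unfolding S.topspace_mtopology using \<sigma> by auto
    moreover have "y \<circ> r = (\<lambda>_. \<sigma> i)" using r(2) by (auto simp: n)
    ultimately have "limitin S.mtopology (y \<circ> r) (\<sigma> i) sequentially"
      by simp
    then show ?thesis using S.MCauchy_convergent_subsequence[OF y r(1)] by blast
  qed
  then show ?thesis unfolding mcomplete_of_def S.mcomplete_def by blast
qed

lemma subsequential_iff_complete_subsets_weak_G_complete:
  "G_Cauchy_subsequential m \<longleftrightarrow>
     (\<forall>A. A \<subseteq> mspace m \<and> mcomplete_of (submetric m A) \<longrightarrow> weak_G_complete (submetric m A))"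
proof (intro iffI allI impI)
  fix A assume "G_Cauchy_subsequential m" "A \<subseteq> mspace m \<and> mcomplete_of (submetric m A)"
  then show "weak_G_complete (submetric m A)"
    using weak_G_complete_iff_subsequential G_Cauchy_subsequential_submetric by blast
next
  assume A: "\<forall>A. A \<subseteq> mspace m \<and> mcomplete_of (submetric m A) \<longrightarrow> weak_G_complete (submetric m A)"
  show "G_Cauchy_subsequential m"
    unfolding G_Cauchy_subsequential_def
  proof (intro allI impI, rule ccontr)
    fix \<sigma> assume \<sigma>: "G_Cauchy m \<sigma>"
      and none: "\<not> (\<exists>r :: nat \<Rightarrow> nat. strict_mono r \<and> Cauchy_in m (\<sigma> \<circ> r))"
    have ran: "range \<sigma> \<subseteq> mspace m" using \<sigma> by (simp add: G_Cauchy_def)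
    have complete: "mcomplete_of (submetric m (range \<sigma>))"
      by (rule mcomplete_range_if_no_Cauchy_subsequence[OF ran none])
    then have "G_Cauchy_subsequential (submetric m (range \<sigma>))"
      using A ran weak_G_complete_iff_subsequential by blast
    then show False
      using \<sigma> none
      unfolding G_Cauchy_subsequential_def Cauchy_in_submetric G_Cauchy_submetric by blast
  qed
qed

section \<open>Images under Cauchy-continuous maps\<close>

lemma Cauchy_continuous_image_cofinally_Cauchy:
  assumes "G_Cauchy_subsequential m"
  shows "Cauchy_continuous_maps_G_Cauchy_to_cofinally_Cauchy m m'"
  unfolding Cauchy_continuous_maps_G_Cauchy_to_cofinally_Cauchy_def
proof (intro allI impI)
  fix f \<sigma> assume f: "Cauchy_continuous_map m m' f" and \<sigma>: "G_Cauchy m \<sigma>"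
  obtain r :: "nat \<Rightarrow> nat" where r: "strict_mono r" and Cau: "Cauchy_in m (\<sigma> \<circ> r)"
    using assms \<sigma> unfolding G_Cauchy_subsequential_def by blast
  have fr: "Cauchy_in m' (f \<circ> (\<sigma> \<circ> r))"
    using f Cau unfolding Cauchy_continuous_map_def by blast
  show "cofinally_Cauchy m' (f \<circ> \<sigma>)"
    unfolding cofinally_Cauchy_def
  proof (intro conjI allI impI)
    show "range (f \<circ> \<sigma>) \<subseteq> mspace m'"
      using Cauchy_continuous_map_funspace[OF f] \<sigma> by (auto simp: G_Cauchy_def)
  next
    fix \<epsilon> :: real assume "\<epsilon> > 0"
    then obtain K where K: "\<And>i j. K \<le> i \<Longrightarrow> K \<le> j \<Longrightarrow> mdist m' (f (\<sigma> (r i))) (f (\<sigma> (r j))) < \<epsilon>"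
      using fr unfolding Cauchy_in_def comp_apply by meson
    have "infinite (r ` {K..})"
      using finite_imageD[OF _ strict_mono_imp_inj_on[OF r]] infinite_Ici by blast
    then show "\<exists>N :: nat set. infinite N \<and>
        (\<forall>p\<in>N. \<forall>q\<in>N. mdist m' ((f \<circ> \<sigma>) p) ((f \<circ> \<sigma>) q) < \<epsilon>)"
      using K by (intro exI[of _ "r ` {K..}"]) auto
  qed
qed

text \<open>The distance to the range of \<open>\<sigma>\<close>, with a penalty on early terms: being close to a
  single \<open>\<sigma> n\<close> does not make it arbitrarily small, only closeness to late terms does.\<close>

definition damped_infdist :: "'a metric \<Rightarrow> (nat \<Rightarrow> 'a) \<Rightarrow> 'a \<Rightarrow> real" where
  "damped_infdist m \<sigma> x = (INF n. mdist m x (\<sigma> n) + inverse (real (Suc n)))"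

lemma damped_infdist_bdd_below: "bdd_below (range (\<lambda>n. mdist m x (\<sigma> n) + inverse (real (Suc n))))"
  by (rule bdd_belowI[of _ 0]) auto

lemma damped_infdist_nonneg: "0 \<le> damped_infdist m \<sigma> x"
  unfolding damped_infdist_def by (rule cINF_greatest) auto

lemma damped_infdist_le: "damped_infdist m \<sigma> x \<le> mdist m x (\<sigma> n) + inverse (real (Suc n))"
  unfolding damped_infdist_def by (rule cINF_lower[OF damped_infdist_bdd_below]) simp

lemma damped_infdist_Lipschitz:
  assumes "range \<sigma> \<subseteq> mspace m" "x \<in> mspace m" "y \<in> mspace m"
  shows "\<bar>damped_infdist m \<sigma> x - damped_infdist m \<sigma> y\<bar> \<le> mdist m x y"
proof -
  have le: "damped_infdist m \<sigma> a - mdist m a b \<le> damped_infdist m \<sigma> b"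
    if "a \<in> mspace m" "b \<in> mspace m" for a b
    unfolding damped_infdist_def[of m \<sigma> b]
  proof (rule cINF_greatest)
    fix n
    have "mdist m a (\<sigma> n) \<le> mdist m a b + mdist m b (\<sigma> n)"
      using assms(1) that by (intro mdist_triangle) auto
    then show "damped_infdist m \<sigma> a - mdist m a b \<le> mdist m b (\<sigma> n) + inverse (real (Suc n))"
      using damped_infdist_le[of m \<sigma> a n] by linarith
  qed simp
  show ?thesis using le[OF assms(2,3)] le[OF assms(3,2)] mdist_commute[of m x y] by linarith
qed

text \<open>Near-minimisers \<open>n k\<close> of the infimum make both summands small: the first says that
  \<open>\<sigma> (n k)\<close> follows the Cauchy sequence \<open>x\<close>, the second that the indices do not stay
  bounded.\<close>

lemma Cauchy_subsequence_if_damped_infdist_tendsto_0: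
  assumes \<sigma>: "range \<sigma> \<subseteq> mspace m" and x: "Cauchy_in m x"
    and lim: "(\<lambda>k. damped_infdist m \<sigma> (x k)) \<longlonglongrightarrow> 0"
  shows "\<exists>r :: nat \<Rightarrow> nat. strict_mono r \<and> Cauchy_in m (\<sigma> \<circ> r)"
proof -
  \<comment> \<open>The infimum need not be attained; the slack \<open>1 / (k + 1)\<close> provides near-minimisers.\<close>
  let ?b = "\<lambda>k. damped_infdist m \<sigma> (x k) + inverse (real (Suc k))"
  have "\<exists>n. mdist m (x k) (\<sigma> n) + inverse (real (Suc n)) < ?b k" for k
    using cINF_less_iff[OF _ damped_infdist_bdd_below, of m "x k" \<sigma> "?b k"]
    unfolding damped_infdist_def by auto
  then obtain n where n: "\<And>k. mdist m (x k) (\<sigma> (n k)) + inverse (real (Suc (n k))) < ?b k"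
    by metis
  have b: "?b \<longlonglongrightarrow> 0" using tendsto_add[OF lim LIMSEQ_inverse_real_of_nat] by simp
  have "mdist m (x k) (\<sigma> (n k)) \<le> ?b k" for k
    using n[of k] inverse_nonnegative_iff_nonnegative[of "real (Suc (n k))"] by linarith
  then have "(\<lambda>k. mdist m (x k) ((\<sigma> \<circ> n) k)) \<longlonglongrightarrow> 0"
    by (intro tendsto_sandwich[OF _ _ tendsto_const b]) auto
  then have "Cauchy_in m (\<sigma> \<circ> n)" using \<sigma> by (intro Cauchy_in_close[OF x]) auto
  moreover have "inverse (real (Suc (n k))) \<le> ?b k" for k
    using n[of k] mdist_nonneg[of m "x k" "\<sigma> (n k)"] by linarith
  then have "(\<lambda>k. inverse (real (Suc (n k)))) \<longlonglongrightarrow> 0"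
    by (intro tendsto_sandwich[OF _ _ tendsto_const b]) auto
  then have "infinite (range n)" by (rule infinite_range_if_inverse_tendsto_0)
  ultimately show ?thesis by (rule Cauchy_subsequence_of_reindexing)
qed

text \<open>The map is the reciprocal of \<open>damped_infdist\<close>. The limits of \<open>damped_infdist\<close> along
  Cauchy sequences are nonzero, which is exactly what keeps the reciprocal Cauchy-continuous;
  continuity of the reciprocal alone would not suffice when the space is incomplete.\<close>

lemma Cauchy_continuous_real_map_unbounded_along:
  assumes \<sigma>: "range \<sigma> \<subseteq> mspace m"
    and none: "\<not> (\<exists>r :: nat \<Rightarrow> nat. strict_mono r \<and> Cauchy_in m (\<sigma> \<circ> r))"
  obtains f :: "'a \<Rightarrow> real" where "Cauchy_continuous_map m euclidean_metric f"
    "filterlim (f \<circ> \<sigma>) at_top sequentially"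
proof -
  let ?h = "damped_infdist m \<sigma>"
  have lim: "\<exists>L. L \<noteq> 0 \<and> (\<lambda>k. ?h (x k)) \<longlonglongrightarrow> L" if x: "Cauchy_in m x" for x
  proof -
    have "x k \<in> mspace m" for k using x unfolding Cauchy_in_def by auto
    then have h: "\<bar>?h (x i) - ?h (x j)\<bar> \<le> mdist m (x i) (x j)" for i j
      using damped_infdist_Lipschitz[OF \<sigma>] by blast
    have "Cauchy (\<lambda>k. ?h (x k))"
    proof (rule metric_CauchyI)
      fix \<epsilon> :: real assume "\<epsilon> > 0"
      then obtain N where "\<And>i j. N \<le> i \<Longrightarrow> N \<le> j \<Longrightarrow> mdist m (x i) (x j) < \<epsilon>"
        using x unfolding Cauchy_in_def by meson
      then show "\<exists>N. \<forall>i\<ge>N. \<forall>j\<ge>N. dist (?h (x i)) (?h (x j)) < \<epsilon>"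
        unfolding dist_real_def using le_less_trans[OF h] by blast
    qed
    then obtain L where L: "(\<lambda>k. ?h (x k)) \<longlonglongrightarrow> L"
      using Cauchy_convergent unfolding convergent_def by blast
    moreover have "L \<noteq> 0"
    proof
      assume "L = 0"
      with L have "(\<lambda>k. ?h (x k)) \<longlonglongrightarrow> 0" by simp
      with none show False
        using Cauchy_subsequence_if_damped_infdist_tendsto_0[OF \<sigma> x] by simp
    qed
    ultimately show ?thesis by blast
  qed
  have "Cauchy_continuous_map m euclidean_metric (\<lambda>x. inverse (?h x))"
    unfolding Cauchy_continuous_map_def
  proof (intro allI impI)
    fix x assume "Cauchy_in m x"
    then obtain L where "L \<noteq> 0" "(\<lambda>k. ?h (x k)) \<longlonglongrightarrow> L" using lim by blast
    then have "(\<lambda>k. inverse (?h (x k))) \<longlonglongrightarrow> inverse L" by (intro tendsto_inverse)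
    then show "Cauchy_in euclidean_metric ((\<lambda>x. inverse (?h x)) \<circ> x)"
      using LIMSEQ_imp_Cauchy by (simp add: o_def)
  qed
  moreover have "real (Suc n) \<le> inverse (?h (\<sigma> n))" for n
  proof -
    have "\<sigma> n \<in> mspace m" using \<sigma> by auto
    \<comment> \<open>Positivity at a point is the statement on limits for a constant sequence.\<close>
    then have "Cauchy_in m (\<lambda>_. \<sigma> n)"
      by (simp add: Metric_space.MCauchy_const[OF Metric_space_mspace_mdist])
    then obtain L where "L \<noteq> 0" "(\<lambda>_. ?h (\<sigma> n)) \<longlonglongrightarrow> L" using lim by blast
    then have "?h (\<sigma> n) \<noteq> 0" by (simp add: LIMSEQ_const_iff)
    then have "?h (\<sigma> n) > 0" using damped_infdist_nonneg[of m \<sigma> "\<sigma> n"] by linarith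
    moreover have "mdist m (\<sigma> n) (\<sigma> n) = 0" using \<open>\<sigma> n \<in> mspace m\<close> by simp
    then have "?h (\<sigma> n) \<le> inverse (real (Suc n))"
      using damped_infdist_le[of m \<sigma> "\<sigma> n" n] by linarith
    ultimately show ?thesis
      using le_imp_inverse_le[of "?h (\<sigma> n)" "inverse (real (Suc n))"] by (simp only: inverse_inverse_eq)
  qed
  then have "filterlim ((\<lambda>x. inverse (?h x)) \<circ> \<sigma>) at_top sequentially"
    unfolding o_def
    by (intro filterlim_at_top_mono[OF filterlim_compose[OF filterlim_real_sequentially filterlim_Suc]]
        always_eventually allI)
  ultimately show thesis by (rule that)
qed

lemma not_cofinally_Cauchy_if_tendsto_infinity:
  fixes u :: "nat \<Rightarrow> real"
  assumes "filterlim u at_top sequentially"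
  shows "\<not> cofinally_Cauchy euclidean_metric u"
proof
  assume "cofinally_Cauchy euclidean_metric u"
  then have "\<forall>\<epsilon>>0. \<exists>N. infinite N \<and> (\<forall>p\<in>N. \<forall>q\<in>N. dist (u p) (u q) < \<epsilon>)"
    by (simp add: cofinally_Cauchy_def)
  from this[rule_format, OF zero_less_one]
  obtain N where N: "infinite N" "\<And>p q. p \<in> N \<Longrightarrow> q \<in> N \<Longrightarrow> dist (u p) (u q) < 1"
    by blast
  obtain p where p: "p \<in> N" using infinite_imp_nonempty[OF N(1)] by blast
  have "\<forall>\<^sub>F n in sequentially. u p + 1 \<le> u n"
    using assms by (simp add: filterlim_at_top)
  then obtain K where K: "\<And>n. K \<le> n \<Longrightarrow> u p + 1 \<le> u n"
    by (auto simp: eventually_sequentially)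
  obtain q where "q \<in> N" "K \<le> q"
    using N(1) unfolding infinite_nat_iff_unbounded_le by blast
  then show False using N(2)[OF p, of q] K[of q] by (simp add: dist_real_def)
qed

lemma subsequential_if_real_images_cofinally_Cauchy:
  assumes "Cauchy_continuous_maps_G_Cauchy_to_cofinally_Cauchy m (euclidean_metric :: real metric)"
  shows "G_Cauchy_subsequential m"
  unfolding G_Cauchy_subsequential_def
proof (intro allI impI, rule ccontr)
  fix \<sigma> assume \<sigma>: "G_Cauchy m \<sigma>"
    and none: "\<not> (\<exists>r :: nat \<Rightarrow> nat. strict_mono r \<and> Cauchy_in m (\<sigma> \<circ> r))"
  have ran: "range \<sigma> \<subseteq> mspace m" using \<sigma> by (simp add: G_Cauchy_def)
  obtain f :: "'a \<Rightarrow> real" where f: "Cauchy_continuous_map m euclidean_metric f"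
      and lim: "filterlim (f \<circ> \<sigma>) at_top sequentially"
    by (rule Cauchy_continuous_real_map_unbounded_along[OF ran none])
  have "cofinally_Cauchy euclidean_metric (f \<circ> \<sigma>)"
    using assms f \<sigma> unfolding Cauchy_continuous_maps_G_Cauchy_to_cofinally_Cauchy_def by blast
  then show False using not_cofinally_Cauchy_if_tendsto_infinity[OF lim] by contradiction
qed

text \<open>Transporting a metric along an injection. This allows a metric space of reals to be realised
  on any type that is large enough.\<close>

lemma isometric_copy_on_larger_type:
  fixes m :: "'a metric"
  assumes "(UNIV :: 'a set) \<lesssim> (UNIV :: 'b set)"
  obtains g :: "'a \<Rightarrow> 'b" and m' :: "'b metric" where "g \<in> mspace m \<rightarrow> mspace m'"
    "\<forall>x\<in>mspace m. \<forall>y\<in>mspace m. mdist m' (g x) (g y) = mdist m x y"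
proof -
  obtain g :: "'a \<Rightarrow> 'b" where g: "inj g" using assms unfolding lepoll_def by blast
  let ?M = "g ` mspace m" and ?d = "\<lambda>a b. mdist m (inv g a) (inv g b)"
  interpret Metric_space ?M ?d
  proof
    show "?d a b = ?d b a" for a b by (rule mdist_commute)
    show "?d a c \<le> ?d a b + ?d b c" if "a \<in> ?M" "b \<in> ?M" "c \<in> ?M" for a b c
      using that g by (intro mdist_triangle) auto
  qed (use g in auto)
  show thesis
    by (rule that[of g "metric (?M, ?d)"]) (auto simp: g)
qed

lemma images_cofinally_Cauchy_isometric:
  assumes g: "g \<in> mspace m' \<rightarrow> mspace m''"
    and iso: "\<And>x y. x \<in> mspace m' \<Longrightarrow> y \<in> mspace m' \<Longrightarrow> mdist m'' (g x) (g y) = mdist m' x y"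
    and cof: "Cauchy_continuous_maps_G_Cauchy_to_cofinally_Cauchy m m''"
  shows "Cauchy_continuous_maps_G_Cauchy_to_cofinally_Cauchy m m'"
  unfolding Cauchy_continuous_maps_G_Cauchy_to_cofinally_Cauchy_def
proof (intro allI impI)
  fix f \<sigma> assume f: "Cauchy_continuous_map m m' f" and \<sigma>: "G_Cauchy m \<sigma>"
  have ran: "range (f \<circ> \<sigma>) \<subseteq> mspace m'"
    using Cauchy_continuous_map_funspace[OF f] \<sigma> by (auto simp: G_Cauchy_def)
  have "Cauchy_in m'' (g \<circ> f \<circ> x)" if "Cauchy_in m x" for x
  proof -
    have "Cauchy_in m' (f \<circ> x)" using f that unfolding Cauchy_continuous_map_def by blast
    moreover from this have "range (f \<circ> x) \<subseteq> mspace m'" unfolding Cauchy_in_def by blast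
    ultimately show ?thesis
      using Cauchy_in_isometry_iff[OF g iso, of "f \<circ> x"] by (simp add: comp_assoc)
  qed
  then have "Cauchy_continuous_map m m'' (g \<circ> f)" unfolding Cauchy_continuous_map_def by blast
  then have gf: "cofinally_Cauchy m'' (g \<circ> f \<circ> \<sigma>)"
    using cof \<sigma> unfolding Cauchy_continuous_maps_G_Cauchy_to_cofinally_Cauchy_def by blast
  have "mdist m'' (g (f (\<sigma> p))) (g (f (\<sigma> q))) = mdist m' (f (\<sigma> p)) (f (\<sigma> q))" for p q
    using ran by (intro iso) auto
  then show "cofinally_Cauchy m' (f \<circ> \<sigma>)"
    using gf ran by (simp add: cofinally_Cauchy_def)
qed

theorem corollary3p3:
  fixes X :: "'a metric" and cX :: "'c metric" and e :: "'a \<Rightarrow> 'c"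
  assumes completion: "is_completion X cX e"
  shows
    "(weak_G_complete cX \<longleftrightarrow>
       (\<forall>A. A \<subseteq> mspace X \<and> mcomplete_of (submetric X A) \<longrightarrow> weak_G_complete (submetric X A))) \<and>
     (weak_G_complete cX \<longrightarrow>
       (\<forall>Y :: 'y metric. Cauchy_continuous_maps_G_Cauchy_to_cofinally_Cauchy X Y)) \<and>
     ((UNIV :: real set) \<lesssim> (UNIV :: 'y set) \<longrightarrow>
       (\<forall>Y :: 'y metric. Cauchy_continuous_maps_G_Cauchy_to_cofinally_Cauchy X Y) \<longrightarrow>
       weak_G_complete cX) \<and>
     (weak_G_complete cX \<longleftrightarrow>
       Cauchy_continuous_maps_G_Cauchy_to_cofinally_Cauchy X (euclidean_metric :: real metric)) \<and>
     (weak_G_complete cX \<longleftrightarrow>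
       (\<forall>\<sigma>. G_Cauchy X \<sigma> \<longrightarrow>
          (\<exists>r :: nat \<Rightarrow> nat. strict_mono r \<and> Metric_space.MCauchy (mspace X) (mdist X) (\<sigma> \<circ> r))))"
proof -
  have "mcomplete_of cX" using completion by (simp add: is_completion_def)
  then have a_iff_e: "weak_G_complete cX \<longleftrightarrow> G_Cauchy_subsequential X"
    using weak_G_complete_iff_subsequential G_Cauchy_subsequential_completion[OF completion] by blast
  \<comment> \<open>Among the metric spaces on \<open>'y\<close> there is an isometric copy of the real line, and being
    cofinally Cauchy depends on distances only.\<close>
  have c_imp_d: "Cauchy_continuous_maps_G_Cauchy_to_cofinally_Cauchy X (euclidean_metric :: real metric)"
    if le: "(UNIV :: real set) \<lesssim> (UNIV :: 'y set)"
      and c: "\<forall>Y :: 'y metric. Cauchy_continuous_maps_G_Cauchy_to_cofinally_Cauchy X Y"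
  proof -
    obtain g :: "real \<Rightarrow> 'y" and Y :: "'y metric"
      where g: "g \<in> mspace euclidean_metric \<rightarrow> mspace Y"
        and iso: "\<forall>x\<in>mspace euclidean_metric. \<forall>y\<in>mspace euclidean_metric.
          mdist Y (g x) (g y) = mdist euclidean_metric x y"
      by (rule isometric_copy_on_larger_type[OF le, of euclidean_metric])
    show ?thesis
      by (rule images_cofinally_Cauchy_isometric[OF g iso[rule_format] c[rule_format]])
  qed
  show ?thesis
    unfolding a_iff_e
  proof (intro conjI impI)
    show "G_Cauchy_subsequential X \<longleftrightarrow>
        (\<forall>A. A \<subseteq> mspace X \<and> mcomplete_of (submetric X A) \<longrightarrow> weak_G_complete (submetric X A))"
      by (rule subsequential_iff_complete_subsets_weak_G_complete)
    show "\<forall>Y :: 'y metric. Cauchy_continuous_maps_G_Cauchy_to_cofinally_Cauchy X Y"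
      if "G_Cauchy_subsequential X"
      using Cauchy_continuous_image_cofinally_Cauchy[OF that] ..
    show "G_Cauchy_subsequential X"
      if "(UNIV :: real set) \<lesssim> (UNIV :: 'y set)"
        and "\<forall>Y :: 'y metric. Cauchy_continuous_maps_G_Cauchy_to_cofinally_Cauchy X Y"
      by (rule subsequential_if_real_images_cofinally_Cauchy[OF c_imp_d[OF that]])
    show "G_Cauchy_subsequential X \<longleftrightarrow>
        Cauchy_continuous_maps_G_Cauchy_to_cofinally_Cauchy X (euclidean_metric :: real metric)"
      using Cauchy_continuous_image_cofinally_Cauchy subsequential_if_real_images_cofinally_Cauchy
      by (rule iffI)
    show "G_Cauchy_subsequential X \<longleftrightarrow>
        (\<forall>\<sigma>. G_Cauchy X \<sigma> \<longrightarrow> (\<exists>r :: nat \<Rightarrow> nat. strict_mono r \<and> Cauchy_in X (\<sigma> \<circ> r)))"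
      by (rule G_Cauchy_subsequential_def)
  qed
qed

end
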